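(* Let $R$ be an associative ring, not necessarily possessing a unit element. Then the Jacobson radical $J(R)$ is a quite superfluous right ideal of $R$, and every quite superfluous right ideal of $R$ is contained in $J(R)$. (In other words, $J(R)$ is the unique largest quite superfluous right ideal of $R$.)
   Context: Rings are associative and possibly non-unital. A right ideal of $R$ is an additive subgroup $I \subseteq R$ with $ir \in I$ for all $i \in I$, $r \in R$; $R$ itself is a right ideal. An element $a \in R$ is right quasi-regular if there exists $x \in R$ with $ax = a + x$. The Jacobson radical of $R$ is the two-sided ideal $$J(R) = \{ a \in R \mid \text{for all } b \in R,\ ab \text{ is right quasi-regular} \}.$$ A right ideal $I$ of $R$ is regular if there exists an element $e \in R$ such that $er - r \in I$ for all $r \in R$. A right ideal $J$ of $R$ is quite superfluous if for every regular right ideal $I$ of $R$, $J + I = R$ implies $I = R$. *)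

theory Defs
  imports Main "HOL-Library.Set_Algebras"
begin

(* The ring R is the whole type 'a of class ring, which is associative but does not
   assume a multiplicative unit. The sum of two right ideals is the elementwise sum
   of sets from Set_Algebras. *)

definition right_ideal :: "'a::ring set \<Rightarrow> bool" where
  "right_ideal I \<longleftrightarrow>
     0 \<in> I \<and> (\<forall>x\<in>I. \<forall>y\<in>I. x + y \<in> I) \<and> (\<forall>x\<in>I. - x \<in> I) \<and>
     (\<forall>i\<in>I. \<forall>r. i * r \<in> I)"

definition right_quasi_regular :: "'a::ring \<Rightarrow> bool" where
  "right_quasi_regular a \<longleftrightarrow> (\<exists>x. a * x = a + x)"

definition jacobson_radical :: "'a::ring set" where
  "jacobson_radical = {a. \<forall>b. right_quasi_regular (a * b)}"

definition regular_right_ideal :: "'a::ring set \<Rightarrow> bool" where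
  "regular_right_ideal I \<longleftrightarrow> right_ideal I \<and> (\<exists>e. \<forall>r. e * r - r \<in> I)"

definition quite_superfluous :: "'a::ring set \<Rightarrow> bool" where
  "quite_superfluous J \<longleftrightarrow>
     right_ideal J \<and> (\<forall>I. regular_right_ideal I \<longrightarrow> J + I = UNIV \<longrightarrow> I = UNIV)"

end

theory Submission
  imports Defs
begin

text \<open>
  Adjoin a formal unit. Then \<^prop>\<open>a * x = a + x\<close> says \<open>(1 - a)(1 - x) = 1\<close>, that is,
  \<open>1 - a\<close> is right invertible, and a right ideal \<open>I\<close> is regular when it contains
  \<open>(1 - e)R\<close> for some \<open>e\<close>.

  If \<open>I\<close> is regular with witness \<open>e\<close> and \<open>J(R) + I = R\<close>, write \<open>e = j + i\<close> with \<open>j\<close> in the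
  radical and \<open>i\<close> in \<open>I\<close>. Modulo \<open>I\<close>, left multiplication by \<open>e\<close> is the identity, so
  \<open>(1 - j)s = (1 - e)s + is\<close> lies in \<open>I\<close> for every \<open>s\<close>. As \<open>1 - j\<close> is right invertible,
  \<open>(1 - j)R = R\<close>, and hence \<open>I = R\<close> (lemma \<open>jacobson_radical_superfluous\<close>).

  Conversely, let \<open>a\<close> lie in a quite superfluous right ideal \<open>J\<close>. The right ideal \<open>(1 - a)R\<close> is
  regular with witness \<open>a\<close>, and \<open>aR + (1 - a)R = R\<close> because \<open>r = ar + (1 - a)r\<close>. So
  \<open>(1 - a)R = R\<close>, and solving for \<open>-a\<close> shows that \<open>a\<close> is right quasi-regular. Since \<open>J\<close> is
  closed under right multiplication, all its elements lie in the radical.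
\<close>

text \<open>
  This is \<open>(1 - a - v)(1 - x) = 1 - v(1 - x)\<close> together with \<open>(1 - v(1 - x))(1 - y) = 1\<close>: the
  product \<open>(1 - x)(1 - y)\<close> is a right inverse of \<open>1 - (a + v)\<close>.
\<close>

lemma right_quasi_regular_add:
  fixes a v x :: "'a::ring"
  assumes x: "a * x = a + x" and "right_quasi_regular (v - v * x)"
  shows "right_quasi_regular (a + v)"
proof -
  obtain y where "(v - v * x) * y = v - v * x + y"
    using assms(2) by (auto simp: right_quasi_regular_def)
  then have y: "v * y = v - v * x + y + v * x * y"
    by (simp add: algebra_simps)
  have "a * (x * y) = a * y + x * y"
    by (simp add: x distrib_right flip: mult.assoc)
  then have "(a + v) * (x + y - x * y) = (a + v) + (x + y - x * y)"
    using x y by (simp add: algebra_simps)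
  then show ?thesis
    unfolding right_quasi_regular_def by blast
qed

lemma right_ideal_jacobson_radical: "right_ideal (jacobson_radical :: 'a::ring set)"
  unfolding right_ideal_def
proof (intro conjI ballI allI)
  show "(0::'a) \<in> jacobson_radical"
    by (simp add: jacobson_radical_def right_quasi_regular_def)
next
  fix a b :: 'a
  assume a: "a \<in> jacobson_radical" and b: "b \<in> jacobson_radical"
  have "right_quasi_regular (a * c + b * c)" for c
  proof -
    obtain x where x: "a * c * x = a * c + x"
      using a by (auto simp: jacobson_radical_def right_quasi_regular_def)
    have "right_quasi_regular (b * (c - c * x))"
      using b by (simp add: jacobson_radical_def)
    then have "right_quasi_regular (b * c - b * c * x)"
      by (simp add: algebra_simps)
    with x show ?thesis
      by (rule right_quasi_regular_add)
  qed
  then show "a + b \<in> jacobson_radical"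
    by (simp add: jacobson_radical_def distrib_right)
next
  fix a :: 'a
  assume "a \<in> jacobson_radical"
  then have "right_quasi_regular (a * (- b))" for b
    unfolding jacobson_radical_def by blast
  then show "- a \<in> jacobson_radical"
    by (simp add: jacobson_radical_def)
next
  fix a r :: 'a
  assume "a \<in> jacobson_radical"
  then show "a * r \<in> jacobson_radical"
    by (simp add: jacobson_radical_def mult.assoc)
qed

text \<open>
  Without a unit, \<open>j\<close> need not be of the form \<open>jb\<close>, so this is not immediate from the definition
  of the radical. It follows from the case \<open>b = j\<close> by factoring \<open>1 - jj = (1 - j)(1 + j)\<close>.
\<close>

lemma right_quasi_regular_if_in_jacobson_radical:
  fixes j :: "'a::ring"
  assumes "j \<in> jacobson_radical"
  shows "right_quasi_regular j"
proof -
  obtain x where "j * j * x = j * j + x"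
    using assms by (auto simp: jacobson_radical_def right_quasi_regular_def)
  \<comment> \<open>The witness is \<open>1 - (1 + j)(1 - x)\<close>.\<close>
  then have "j * (x + j * x - j) = j + (x + j * x - j)"
    by (simp add: algebra_simps)
  then show ?thesis
    unfolding right_quasi_regular_def by blast
qed

lemma jacobson_radical_superfluous:
  fixes I :: "'a::ring set"
  assumes I: "regular_right_ideal I" and sum: "jacobson_radical + I = UNIV"
  shows "I = UNIV"
proof -
  have add: "u + v \<in> I" if "u \<in> I" "v \<in> I" for u v
    using I that by (auto simp: regular_right_ideal_def right_ideal_def)
  have neg: "- u \<in> I" if "u \<in> I" for u
    using I that by (auto simp: regular_right_ideal_def right_ideal_def)
  have mult: "u * r \<in> I" if "u \<in> I" for u r
    using I that by (auto simp: regular_right_ideal_def right_ideal_def)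
  obtain e where e: "\<And>r. e * r - r \<in> I"
    using I by (auto simp: regular_right_ideal_def)
  obtain j i where j: "j \<in> jacobson_radical" and i: "i \<in> I" and ji: "e = j + i"
    using sum by (metis UNIV_I set_plus_elim)
  obtain y where y: "j * y = j + y"
    using right_quasi_regular_if_in_jacobson_radical[OF j]
    by (auto simp: right_quasi_regular_def)
  have "r \<in> I" for r
  proof -
    define s where "s = r - y * r"
    have "- (e * s - s) + i * s \<in> I"
      using add neg mult e i by blast
    \<comment> \<open>The element just shown to be in \<open>I\<close> is \<open>(1 - j)s = (1 - j)(1 - y)r = r\<close>.\<close>
    moreover have "- (e * s - s) + i * s = s - j * s"
      by (simp add: ji algebra_simps)
    moreover have "s - j * s = r"
    proof -
      have "j * y * r = j * r + y * r"
        by (simp add: y distrib_right)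
      then show ?thesis
        by (simp add: s_def algebra_simps)
    qed
    ultimately show ?thesis
      by simp
  qed
  then show ?thesis
    by blast
qed

lemma regular_right_ideal_range_diff:
  fixes a :: "'a::ring"
  shows "regular_right_ideal (range (\<lambda>r. a * r - r))"
proof -
  let ?I = "range (\<lambda>r. a * r - r)"
  have "0 \<in> ?I"
    by (rule range_eqI[of _ _ 0]) simp
  moreover have "u + v \<in> ?I" if uv: "u \<in> ?I" "v \<in> ?I" for u v
  proof -
    obtain r s where "u = a * r - r" "v = a * s - s"
      using uv by blast
    then show ?thesis
      by (intro range_eqI[of _ _ "r + s"]) (simp add: algebra_simps)
  qed
  moreover have "- u \<in> ?I" if u: "u \<in> ?I" for u
  proof -
    obtain r where "u = a * r - r"
      using u by blast
    then show ?thesis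
      by (intro range_eqI[of _ _ "- r"]) simp
  qed
  moreover have "u * t \<in> ?I" if u: "u \<in> ?I" for u t
  proof -
    obtain r where "u = a * r - r"
      using u by blast
    then have "u * t = a * (r * t) - r * t"
      by (simp add: left_diff_distrib mult.assoc)
    then show ?thesis
      by (rule range_eqI)
  qed
  ultimately show ?thesis
    unfolding regular_right_ideal_def right_ideal_def by blast
qed

lemma right_quasi_regular_if_in_quite_superfluous:
  fixes a :: "'a::ring"
  assumes J: "quite_superfluous J" and a: "a \<in> J"
  shows "right_quasi_regular a"
proof -
  let ?I = "range (\<lambda>r. a * r - r)"
  have "r \<in> J + ?I" for r
  proof -
    have "a * r \<in> J"
      using J a by (auto simp: quite_superfluous_def right_ideal_def)
    moreover have "a * (- r) - (- r) \<in> ?I"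
      by (rule rangeI)
    ultimately have "a * r + (a * (- r) - (- r)) \<in> J + ?I"
      by (rule set_plus_intro)
    then show ?thesis
      by simp
  qed
  then have "J + ?I = UNIV"
    by blast
  then have "?I = UNIV"
    using J regular_right_ideal_range_diff[of a] unfolding quite_superfluous_def by blast
  then obtain x where "a = a * x - x"
    by blast
  then have "a * x = a + x"
    by (metis diff_add_cancel)
  then show ?thesis
    unfolding right_quasi_regular_def by blast
qed

theorem theorem3p3:
  shows "quite_superfluous (jacobson_radical :: 'a::ring set) \<and>
    (\<forall>J :: 'a set. quite_superfluous J \<longrightarrow> J \<subseteq> jacobson_radical)"
proof (intro conjI allI impI)
  show "quite_superfluous (jacobson_radical :: 'a set)"
    unfolding quite_superfluous_def
    using right_ideal_jacobson_radical jacobson_radical_superfluous by blast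
next
  fix J :: "'a set"
  assume J: "quite_superfluous J"
  show "J \<subseteq> jacobson_radical"
  proof
    fix a
    assume "a \<in> J"
    then have "a * b \<in> J" for b
      using J by (auto simp: quite_superfluous_def right_ideal_def)
    then show "a \<in> jacobson_radical"
      using right_quasi_regular_if_in_quite_superfluous[OF J]
      by (simp add: jacobson_radical_def)
  qed
qed

end
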